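(* Let $(X,\|\cdot\|)$ be an infinite-dimensional Banach space (real or complex). Then for every $\varepsilon>0$, $X$ admits an equivalent norm $|||\cdot|||$ such that $\|x\|\le|||x|||\le(1+\varepsilon)\|x\|$ for all $x\in X$ and such that, for some $\delta>0$, the unit sphere of $(X,|||\cdot|||)$ contains an infinite symmetrically $(1+\delta)$-separated subset (with respect to $|||\cdot|||$).
   Context: For $\sigma>0$, a subset $A$ of a normed space is symmetrically $\sigma$-separated if $\|x\pm y\|\ge\sigma$ (both signs) for all distinct $x,y\in A$. *)

theory Defs
  imports "HOL-Analysis.Analysis"
begin

text \<open>
  The scalar multiplication is an explicit parameter, so that the same notions apply
  to real spaces (\<^term>\<open>scaleR\<close>) and to complex ones, for which \<open>HOL-Analysis\<close> has no type class.
  Nonnegativity of the norm follows from the three axioms.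
\<close>

locale normed_space_over = vector_space sc
  for sc :: "'k::real_normed_field \<Rightarrow> 'a::ab_group_add \<Rightarrow> 'a" +
  fixes nrm :: "'a \<Rightarrow> real"
  assumes nrm_eq_0_iff: "nrm x = 0 \<longleftrightarrow> x = 0"
    and nrm_triangle: "nrm (x + y) \<le> nrm x + nrm y"
    and nrm_scale: "nrm (sc c x) = norm c * nrm x"

text \<open>
  A complex Banach space is a real Banach space (type class \<^class>\<open>banach\<close>) carrying a complex
  scalar multiplication that extends the real one and for which the norm is complex homogeneous.
\<close>

definition complex_banach_structure :: "(complex \<Rightarrow> 'a::banach \<Rightarrow> 'a) \<Rightarrow> bool" where
  "complex_banach_structure scaleC \<longleftrightarrow>
     normed_space_over scaleC norm \<and> (\<forall>r x. scaleC (complex_of_real r) x = r *\<^sub>R x)"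

definition infinite_dimensional :: "('k::field \<Rightarrow> 'a::ab_group_add \<Rightarrow> 'a) \<Rightarrow> bool" where
  "infinite_dimensional sc \<longleftrightarrow>
     vector_space sc \<and> (\<nexists>B. finite_dimensional_vector_space sc B)"

definition equivalent_norms :: "('a \<Rightarrow> real) \<Rightarrow> ('a \<Rightarrow> real) \<Rightarrow> bool" where
  "equivalent_norms M N \<longleftrightarrow> (\<exists>c>0. \<exists>C>0. \<forall>x. c * M x \<le> N x \<and> N x \<le> C * M x)"

definition symmetrically_separated :: "('a::ab_group_add \<Rightarrow> real) \<Rightarrow> real \<Rightarrow> 'a set \<Rightarrow> bool" where
  "symmetrically_separated N \<sigma> A \<longleftrightarrow>
     (\<forall>x\<in>A. \<forall>y\<in>A. x \<noteq> y \<longrightarrow> N (x + y) \<ge> \<sigma> \<and> N (x - y) \<ge> \<sigma>)"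

end

theory Submission
  imports Defs "HOL-Library.Ramsey"
begin

text \<open>
  Mazur's construction gives unit vectors \<open>x\<^sub>n\<close> with \<open>\<parallel>x\<^sub>m \<plusminus> x\<^sub>n\<parallel> \<ge> 1 - \<eta>\<close> for \<open>m \<noteq> n\<close> and with the
  distance of each \<open>x\<^sub>n\<close> to the span of the others bounded below. Let \<open>g\<^sub>n\<close> be the distance to the
  span of \<open>{x\<^sub>k | k \<noteq> n}\<close>, scaled so that \<open>g\<^sub>n x\<^sub>n = 1\<close>, and let \<open>p\<close> be the supremum of
  \<open>g\<^sub>i + g\<^sub>j\<close> over \<open>i \<noteq> j\<close>. This bounded seminorm has \<open>p x\<^sub>n = 1\<close> but
  \<open>p (x\<^sub>m \<plusminus> x\<^sub>n) \<ge> 2\<close>, so for small \<open>e\<close> and much smaller \<open>\<eta>\<close> the norm \<open>\<parallel>x\<parallel> + e p x\<close> works.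
\<close>

section \<open>Norm inequalities and the quotient seminorm of a subspace\<close>

context normed_space_over
begin

lemma nrm_zero [simp]: "nrm 0 = 0"
  by (simp add: nrm_eq_0_iff)

lemma nrm_minus [simp]: "nrm (- x) = nrm x"
  using nrm_scale[of "-1" x] by (simp add: scale_minus_left)

lemma nrm_nonneg [simp]: "0 \<le> nrm x"
  using nrm_triangle[of x "- x"] by simp

lemma nrm_pos_iff: "0 < nrm x \<longleftrightarrow> x \<noteq> 0"
  using nrm_eq_0_iff[of x] nrm_nonneg[of x] by (smt (verit))

lemma nrm_minus_commute: "nrm (x - y) = nrm (y - x)"
  by (metis minus_diff_eq nrm_minus)

lemma nrm_triangle_diff: "nrm (x - y) \<le> nrm x + nrm y"
  using nrm_triangle[of x "- y"] by simp

lemma nrm_add_ge: "nrm x - nrm y \<le> nrm (x + y)"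
  using nrm_triangle_diff[of "x + y" y] by simp

text \<open>For \<open>t\<close> nonzero, factor out \<open>t\<close>: \<open>y + sc t u\<close> is
  \<open>t\<close> times the difference of \<open>u\<close> and a vector of \<open>V\<close>. This
  controls the coefficient of \<open>u\<close> by the norm of the whole vector.\<close>

lemma nrm_scale_ge_of_gap:
  assumes V: "subspace V" and d: "\<And>y. y \<in> V \<Longrightarrow> d \<le> nrm (u - y)" and y: "y \<in> V"
  shows "norm t * d \<le> nrm (y + sc t u)"
proof (cases "t = 0")
  case False
  let ?y = "sc (- inverse t) y"
  have "y + sc t u = sc t (u - ?y)"
    using False by (simp add: scale_right_distrib scale_right_diff_distrib add.commute)
  moreover have "d \<le> nrm (u - ?y)"
    using V y by (intro d subspace_scale)
  ultimately show ?thesis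
    by (simp add: nrm_scale mult_left_mono)
qed simp

text \<open>The distance from \<open>v\<close> to \<open>V\<close>, that is, the norm of the coset
  of \<open>v\<close> modulo \<open>V\<close>. It is a seminorm for each subspace \<open>V\<close>,
  closed or not.\<close>

definition quotient_nrm :: "'a set \<Rightarrow> 'a \<Rightarrow> real" where
  "quotient_nrm V v = (INF z\<in>V. nrm (v - z))"

lemma quotient_nrm_bdd_below: "bdd_below ((\<lambda>z. nrm (v - z)) ` V)"
  by (rule bdd_belowI[of _ 0]) auto

lemma quotient_nrm_lower: "z \<in> V \<Longrightarrow> quotient_nrm V v \<le> nrm (v - z)"
  unfolding quotient_nrm_def by (rule cINF_lower[OF quotient_nrm_bdd_below])

lemma quotient_nrm_greatest:
  "subspace V \<Longrightarrow> (\<And>z. z \<in> V \<Longrightarrow> c \<le> nrm (v - z)) \<Longrightarrow> c \<le> quotient_nrm V v"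
  unfolding quotient_nrm_def using subspace_0 by (intro cINF_greatest) auto

lemma quotient_nrm_nonneg: "subspace V \<Longrightarrow> 0 \<le> quotient_nrm V v"
  by (rule quotient_nrm_greatest) auto

lemma quotient_nrm_le: "subspace V \<Longrightarrow> quotient_nrm V v \<le> nrm v"
  using quotient_nrm_lower[OF subspace_0, of V v] by simp

lemma quotient_nrm_eq_0: "subspace V \<Longrightarrow> v \<in> V \<Longrightarrow> quotient_nrm V v = 0"
  using quotient_nrm_lower[of v V v] quotient_nrm_nonneg[of V v] by simp

lemma quotient_nrm_triangle:
  assumes V: "subspace V"
  shows "quotient_nrm V (a + b) \<le> quotient_nrm V a + quotient_nrm V b"
proof -
  have "quotient_nrm V (a + b) - nrm (a - y) \<le> quotient_nrm V b" if y: "y \<in> V" for y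
  proof (rule quotient_nrm_greatest[OF V])
    fix z assume z: "z \<in> V"
    have "quotient_nrm V (a + b) \<le> nrm (a + b - (y + z))"
      using V y z by (intro quotient_nrm_lower subspace_add)
    also have "a + b - (y + z) = (a - y) + (b - z)"
      by simp
    also have "nrm \<dots> \<le> nrm (a - y) + nrm (b - z)"
      by (rule nrm_triangle)
    finally show "quotient_nrm V (a + b) - nrm (a - y) \<le> nrm (b - z)"
      by simp
  qed
  then have "quotient_nrm V (a + b) - quotient_nrm V b \<le> quotient_nrm V a"
    by (intro quotient_nrm_greatest[OF V]) (auto simp: algebra_simps)
  then show ?thesis
    by simp
qed

lemma quotient_nrm_scale_le:
  assumes V: "subspace V"
  shows "quotient_nrm V (sc c a) \<le> norm c * quotient_nrm V a"
proof (cases "c = 0")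
  case True
  then show ?thesis
    using V by (simp add: quotient_nrm_eq_0 subspace_0)
next
  case False
  have "quotient_nrm V (sc c a) / norm c \<le> quotient_nrm V a"
  proof (rule quotient_nrm_greatest[OF V])
    fix z assume "z \<in> V"
    then have "quotient_nrm V (sc c a) \<le> nrm (sc c a - sc c z)"
      using V by (intro quotient_nrm_lower subspace_scale)
    also have "\<dots> = norm c * nrm (a - z)"
      by (simp add: scale_right_diff_distrib[symmetric] nrm_scale)
    finally show "quotient_nrm V (sc c a) / norm c \<le> nrm (a - z)"
      using False by (simp add: field_simps)
  qed
  then show ?thesis
    using False by (simp add: field_simps)
qed

text \<open>The missing inequality is \<open>quotient_nrm_scale_le\<close> applied to
  \<open>inverse c\<close> and \<open>sc c a\<close>.\<close>

lemma quotient_nrm_scale: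
  assumes V: "subspace V"
  shows "quotient_nrm V (sc c a) = norm c * quotient_nrm V a"
proof (cases "c = 0")
  case True
  then show ?thesis
    using V by (simp add: quotient_nrm_eq_0 subspace_0)
next
  case False
  then have "quotient_nrm V a \<le> norm (inverse c) * quotient_nrm V (sc c a)"
    using quotient_nrm_scale_le[OF V, of "inverse c" "sc c a"] by simp
  then have "norm c * quotient_nrm V a \<le> quotient_nrm V (sc c a)"
    using False by (simp add: norm_divide field_simps)
  then show ?thesis
    using quotient_nrm_scale_le[OF V, of c a] by simp
qed

lemma quotient_nrm_add_cancel:
  assumes V: "subspace V" and b: "b \<in> V"
  shows "quotient_nrm V (a + b) = quotient_nrm V a"
proof (rule antisym)
  show "quotient_nrm V (a + b) \<le> quotient_nrm V a"
    using quotient_nrm_triangle[OF V, of a b] quotient_nrm_eq_0[OF V b] by simp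
  show "quotient_nrm V a \<le> quotient_nrm V (a + b)"
    using quotient_nrm_triangle[OF V, of "a + b" "- b"]
      quotient_nrm_eq_0[OF V subspace_neg[OF V b]] by simp
qed

end

section \<open>Finite-dimensional subspaces: closedness and total boundedness\<close>

text \<open>The sort \<open>heine_borel\<close> makes the scalar field complete with compact closed
  balls and covers the real and the complex case at once.\<close>

locale infinite_dimensional_normed_space = normed_space_over sc nrm
  for sc :: "'k::{real_normed_field,heine_borel} \<Rightarrow> 'a::ab_group_add \<Rightarrow> 'a" and nrm +
  assumes infinite_dim: "infinite_dimensional sc"
begin

text \<open>Finite-dimensional subspaces are closed. In the induction, let
  \<open>s n + sc (t n) u\<close> come arbitrarily close to \<open>v\<close>. As \<open>u\<close>
  has positive distance to \<open>span S\<close>, the coefficients \<open>t n\<close> converge to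
  some \<open>t0\<close>, and then \<open>v - sc t0 u\<close> has distance zero to
  \<open>span S\<close>, against the induction hypothesis.\<close>

lemma finite_span_gap:
  assumes "finite S" and "v \<notin> span S"
  shows "\<exists>d>0. \<forall>y\<in>span S. d \<le> nrm (v - y)"
  using assms
proof (induction S arbitrary: v rule: finite_induct)
  case empty
  then show ?case
    by (intro exI[of _ "nrm v"]) (auto simp: nrm_pos_iff)
next
  case (insert u S)
  show ?case
  proof (cases "u \<in> span S")
    case True
    then show ?thesis
      using insert span_redundant by metis
  next
    case False
    then obtain d where d: "d > 0" "\<And>y. y \<in> span S \<Longrightarrow> d \<le> nrm (u - y)"
      using insert.IH by blast
    show ?thesis
    proof (rule ccontr)
      assume no: "\<not> ?thesis"
      have "\<exists>t s. s \<in> span S \<and> nrm (v - (s + sc t u)) < inverse (real (Suc n))" for n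
      proof -
        obtain y where y: "y \<in> span (insert u S)" "nrm (v - y) < inverse (real (Suc n))"
          using no by (metis inverse_positive_iff_positive not_le of_nat_0_less_iff zero_less_Suc)
        obtain t where "y - sc t u \<in> span S"
          using y(1) span_breakdown_eq by blast
        with y(2) show ?thesis
          by (intro exI[of _ t] exI[of _ "y - sc t u"]) auto
      qed
      then obtain t s where s: "\<And>n. s n \<in> span S"
        and lim: "\<And>n. nrm (v - (s n + sc (t n) u)) < inverse (real (Suc n))"
        by metis
      \<comment> \<open>Two approximants of \<open>v\<close> are close to each other, and the gap
        \<open>d\<close> of \<open>u\<close> turns this into closeness of their
        \<open>u\<close>-coefficients.\<close>
      have tdiff: "norm (t m - t n) * d \<le> inverse (real (Suc m)) + inverse (real (Suc n))" for m n
      proof -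
        have "norm (t m - t n) * d \<le> nrm ((s m - s n) + sc (t m - t n) u)"
          using d(2) s by (intro nrm_scale_ge_of_gap[OF subspace_span] span_diff) auto
        also have "(s m - s n) + sc (t m - t n) u
            = (v - (s n + sc (t n) u)) - (v - (s m + sc (t m) u))"
          by (simp add: scale_left_diff_distrib)
        also have "nrm \<dots> \<le> nrm (v - (s n + sc (t n) u)) + nrm (v - (s m + sc (t m) u))"
          by (rule nrm_triangle_diff)
        finally show ?thesis
          using lim[of m] lim[of n] by simp
      qed
      have "Cauchy t"
      proof (rule CauchyI)
        fix e :: real assume "e > 0"
        then obtain M where M: "inverse (real (Suc M)) < e * d / 2"
          using reals_Archimedean[of "e * d / 2"] d(1) by auto
        have "norm (t m - t n) < e" if "m \<ge> M" "n \<ge> M" for m n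
        proof -
          have "inverse (real (Suc m)) \<le> inverse (real (Suc M))"
            "inverse (real (Suc n)) \<le> inverse (real (Suc M))"
            using that by auto
          then have "norm (t m - t n) * d < e * d"
            using tdiff[of m n] M by linarith
          then show ?thesis
            using d(1) by simp
        qed
        then show "\<exists>M. \<forall>m\<ge>M. \<forall>n\<ge>M. norm (t m - t n) < e"
          by blast
      qed
      then obtain t0 where t0: "t \<longlonglongrightarrow> t0"
        using Cauchy_convergent convergentD by blast
      have "v - sc t0 u \<notin> span S"
        using insert.prems span_breakdown_eq by blast
      then obtain d' where d': "d' > 0" "\<And>y. y \<in> span S \<Longrightarrow> d' \<le> nrm (v - sc t0 u - y)"
        using insert.IH by blast
      have "d' \<le> inverse (real (Suc n)) + norm (t n - t0) * nrm u" for n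
      proof -
        have "d' \<le> nrm (v - sc t0 u - s n)"
          by (rule d'(2)[OF s])
        also have "v - sc t0 u - s n = (v - (s n + sc (t n) u)) + sc (t n - t0) u"
          by (simp add: scale_left_diff_distrib)
        also have "nrm \<dots> \<le> nrm (v - (s n + sc (t n) u)) + norm (t n - t0) * nrm u"
          using nrm_triangle by (simp add: nrm_scale[symmetric])
        finally show ?thesis
          using lim[of n] by simp
      qed
      moreover have "(\<lambda>n. inverse (real (Suc n)) + norm (t n - t0) * nrm u) \<longlonglongrightarrow> 0 + 0 * nrm u"
        using t0 by (intro tendsto_intros LIMSEQ_inverse_real_of_nat tendsto_norm_zero)
          (simp add: LIM_zero)
      ultimately have "d' \<le> 0"
        by (auto intro: LIMSEQ_le_const)
      with d'(1) show False
        by simp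
    qed
  qed
qed

text \<open>By the gap of \<open>u\<close>, a vector of norm at most \<open>r\<close> has
  \<open>u\<close>-coefficient at most \<open>r / d\<close>, so its component in
  \<open>span S\<close> is bounded too. A net of the scalar ball and a net from the induction
  hypothesis combine to the required one.\<close>

lemma finite_span_totally_bounded:
  assumes "finite S" and "e > 0"
  shows "\<exists>T. finite T \<and> (\<forall>y\<in>span S. nrm y \<le> r \<longrightarrow> (\<exists>y'\<in>T. nrm (y - y') \<le> e))"
  using assms
proof (induction S arbitrary: r e rule: finite_induct)
  case empty
  then show ?case
    by (intro exI[of _ "{0}"]) auto
next
  case (insert u S)
  show ?case
  proof (cases "u \<in> span S")
    case True
    then show ?thesis
      using insert span_redundant by metis
  next
    case False
    then obtain d where d: "d > 0" "\<And>y. y \<in> span S \<Longrightarrow> d \<le> nrm (u - y)"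
      using insert.hyps finite_span_gap by blast
    have u: "nrm u > 0"
      using False span_zero nrm_pos_iff by blast
    obtain T where T: "finite T"
      "\<And>y. y \<in> span S \<Longrightarrow> nrm y \<le> r + r / d * nrm u \<Longrightarrow> \<exists>y'\<in>T. nrm (y - y') \<le> e / 2"
      using insert.IH[of "e / 2" "r + r / d * nrm u"] insert.prems by auto
    have "e / (2 * nrm u) > 0"
      using u insert.prems by simp
    then obtain K where K: "finite K" "cball (0::'k) (r / d) \<subseteq> (\<Union>x\<in>K. ball x (e / (2 * nrm u)))"
      using compact_cball[of "0::'k" "r / d"] unfolding compact_eq_totally_bounded by metis
    show ?thesis
    proof (intro exI conjI ballI impI)
      show "finite ((\<lambda>(y, t). y + sc t u) ` (T \<times> K))"
        using T(1) K(1) by auto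
      fix y assume y: "y \<in> span (insert u S)" "nrm y \<le> r"
      obtain t where t: "y - sc t u \<in> span S"
        using y(1) span_breakdown_eq by blast
      have "norm t * d \<le> nrm y"
        using nrm_scale_ge_of_gap[OF subspace_span d(2) t, of t] by simp
      then have tr: "norm t \<le> r / d"
        using y(2) d(1) by (simp add: field_simps)
      have "nrm (y - sc t u) \<le> nrm y + norm t * nrm u"
        using nrm_triangle_diff[of y "sc t u"] by (simp add: nrm_scale)
      also have "\<dots> \<le> r + r / d * nrm u"
        using tr y(2) by (intro add_mono mult_right_mono) auto
      finally obtain y' where y': "y' \<in> T" "nrm (y - sc t u - y') \<le> e / 2"
        using T(2)[OF t] by blast
      obtain t' where t': "t' \<in> K" "dist t' t < e / (2 * nrm u)"
        using tr K(2) by (auto simp: subset_iff)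
      have "nrm (y - (y' + sc t' u)) = nrm ((y - sc t u - y') + sc (t - t') u)"
        by (simp add: algebra_simps)
      also have "\<dots> \<le> nrm (y - sc t u - y') + norm (t - t') * nrm u"
        using nrm_triangle by (simp add: nrm_scale[symmetric])
      also have "\<dots> \<le> e / 2 + e / 2"
        using y'(2) t'(2) u by (intro add_mono) (auto simp: dist_norm norm_minus_commute field_simps)
      finally show "\<exists>y'\<in>(\<lambda>(y, t). y + sc t u) ` (T \<times> K). nrm (y - y') \<le> e"
        using y'(1) t'(1) by force
    qed
  qed
qed

section \<open>Riesz's lemma and a separated sequence of unit vectors\<close>

lemma finite_span_proper:
  assumes "finite S"
  shows "\<exists>v. v \<notin> span S"
proof (rule ccontr)
  assume "\<not> ?thesis"
  then have S: "span S = UNIV"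
    by auto
  obtain B where B: "B \<subseteq> S" "independent B" "S \<subseteq> span B"
    using maximal_independent_subset by blast
  have "span B = UNIV"
    using S B(3) span_minimal[OF B(3) subspace_span] by auto
  then have "finite_dimensional_vector_space sc B"
    using B finite_subset[OF B(1) assms] by unfold_locales auto
  then show False
    using infinite_dim unfolding infinite_dimensional_def by blast
qed

text \<open>Subtract from \<open>v\<close> a point \<open>y0\<close> of the span that attains the
  distance up to a factor 2. The distance to the span is unchanged, and the norm is now less than
  twice that distance; then normalise.\<close>

lemma riesz_unit_vector:
  assumes "finite S"
  shows "\<exists>x. nrm x = 1 \<and> (\<forall>y\<in>span S. 1 / 2 \<le> nrm (x - y))"
proof -
  let ?q = "quotient_nrm (span S)"
  obtain v where v: "v \<notin> span S"
    using finite_span_proper[OF assms] by blast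
  obtain d where "d > 0" "\<forall>y\<in>span S. d \<le> nrm (v - y)"
    using finite_span_gap[OF assms v] by blast
  then have q: "?q v > 0"
    using quotient_nrm_greatest[OF subspace_span, of S d v] by auto
  obtain y0 where y0: "y0 \<in> span S" "nrm (v - y0) < 2 * ?q v"
  proof (rule ccontr)
    assume "\<not> thesis"
    then have "2 * ?q v \<le> ?q v"
      using that by (intro quotient_nrm_greatest[OF subspace_span]) (meson not_le)
    with q show False
      by simp
  qed
  define w where "w = v - y0"
  have qw: "?q w = ?q v"
    using quotient_nrm_add_cancel[OF subspace_span span_neg[OF y0(1)], of v] by (simp add: w_def)
  have w: "nrm w > 0"
    using q qw quotient_nrm_le[OF subspace_span, of S w] by simp
  define x where "x = sc (of_real (1 / nrm w)) w"
  have qx: "?q x = ?q w / nrm w"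
    using w by (simp add: x_def quotient_nrm_scale norm_divide)
  have "1 / 2 \<le> ?q x"
    unfolding qx qw using y0(2) w by (simp add: w_def[symmetric] field_simps)
  then have "\<forall>y\<in>span S. 1 / 2 \<le> nrm (x - y)"
    using quotient_nrm_lower order_trans by blast
  moreover have "nrm x = 1"
    using w by (simp add: x_def nrm_scale norm_divide)
  ultimately show ?thesis
    by blast
qed

lemma separated_unit_sequence:
  "\<exists>z :: nat \<Rightarrow> 'a. (\<forall>n. nrm (z n) = 1) \<and> (\<forall>m n. m \<noteq> n \<longrightarrow> 1 / 2 \<le> nrm (z m - z n))"
proof -
  \<comment> \<open>\<open>P f n r\<close> depends on \<open>f\<close> only below \<open>n\<close>,
    as the recursive choice demands: each vector is far from the span of its predecessors.\<close>
  define P where "P f n r \<longleftrightarrow> nrm r = 1 \<and> (\<forall>y\<in>span (f ` {..<n}). 1 / 2 \<le> nrm (r - y))"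
    for f :: "nat \<Rightarrow> 'a" and n r
  have "\<exists>f. \<forall>n. P f n (f n)"
  proof (rule dependent_wellorder_choice)
    show "P f n r = P g n r" if "\<And>y. y < n \<Longrightarrow> f y = g y" for r f g n
    proof -
      have "f ` {..<n} = g ` {..<n}"
        using that by (intro image_cong) auto
      then show ?thesis
        unfolding P_def by simp
    qed
    show "\<exists>r. P f n r" for n f
      unfolding P_def by (intro riesz_unit_vector) simp
  qed
  then obtain z where z: "\<And>n. P z n (z n)"
    by blast
  have "1 / 2 \<le> nrm (z n - z m)" if "m < n" for m n
    using z[of n] that unfolding P_def by (auto intro: span_base)
  then have "1 / 2 \<le> nrm (z m - z n)" if "m \<noteq> n" for m n
    using that by (metis nrm_minus_commute linorder_neqE_nat)
  then show ?thesis
    using z unfolding P_def by blast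
qed

section \<open>Mazur's lemma, obtained from telescoping sums and Ramsey's theorem\<close>

text \<open>
  Convexity replaces the Hahn--Banach functionals of the usual proof: the average of the vectors
  \<open>y + t (z\<^sub>k - z\<^sub>k\<^sub>+\<^sub>1)\<close> over a long chain is close to \<open>y\<close>, so not all of them can be
  shorter than \<open>y\<close> by a fixed amount.
\<close>

lemma telescoping_average:
  assumes z: "\<And>n. nrm (z n) = 1" and e: "e > 0"
  shows "\<exists>k::nat. nrm y - e \<le> nrm (y + sc t (z k - z (Suc k)))"
proof (rule ccontr)
  assume no: "\<not> ?thesis"
  have sum: "nrm (sc (of_nat K) y + sc t (z 0 - z K)) \<le> real K * (nrm y - e)" for K
  proof (induction K)
    case (Suc K)
    have "sc (of_nat (Suc K)) y + sc t (z 0 - z (Suc K))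
        = (sc (of_nat K) y + sc t (z 0 - z K)) + (y + sc t (z K - z (Suc K)))"
      by (simp add: scale_left_distrib scale_right_diff_distrib)
    then have "nrm (sc (of_nat (Suc K)) y + sc t (z 0 - z (Suc K)))
        \<le> nrm (sc (of_nat K) y + sc t (z 0 - z K)) + nrm (y + sc t (z K - z (Suc K)))"
      using nrm_triangle by metis
    also have "\<dots> \<le> real K * (nrm y - e) + (nrm y - e)"
      using Suc.IH no by (intro add_mono) (auto simp: not_le intro: less_imp_le)
    finally show ?case
      by (simp add: algebra_simps)
  qed simp
  \<comment> \<open>\<open>K\<close> is chosen so that \<open>K * e\<close> exceeds
    \<open>2 * norm t\<close>, which bounds the term left over after telescoping.\<close>
  obtain K :: nat where K: "norm t * 2 / e < real K"
    using reals_Archimedean2 by blast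
  have "nrm (sc (of_nat K) y) - nrm (sc t (z 0 - z K)) \<le> real K * (nrm y - e)"
    using nrm_add_ge sum order_trans by blast
  then have "real K * e \<le> norm t * nrm (z 0 - z K)"
    unfolding nrm_scale by (simp add: right_diff_distrib mult.commute)
  also have "\<dots> \<le> norm t * 2"
    using nrm_triangle_diff[of "z 0" "z K"] z by (intro mult_left_mono) auto
  finally show False
    using K e by (simp add: field_simps)
qed

text \<open>\<open>telescoping_average\<close> serves one pair \<open>(y, t)\<close>; Ramsey's
  theorem makes one difference serve all of \<open>T\<close>. Colour \<open>{m, n}\<close> by the
  first pair of \<open>T\<close> whose inequality fails, or by \<open>N\<close> if none does. On an
  infinite homogeneous set a colour other than \<open>N\<close> would contradict the telescoping
  argument along consecutive elements.\<close>

lemma simultaneous_long_differences: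
  assumes z: "\<And>n::nat. nrm (z n) = 1" and e: "e > 0" and T: "finite T"
  shows "\<exists>m n. m < n \<and> (\<forall>(y, t)\<in>T. nrm y - e \<le> nrm (y + sc t (z m - z n)))"
proof -
  define good where "good m n p \<longleftrightarrow> nrm (fst p) - e \<le> nrm (fst p + sc (snd p) (z m - z n))"
    for m n p
  obtain N :: nat and g where g: "T = g ` {i. i < N}"
    using finite_imp_nat_seg_image_inj_on[OF T] by blast
  define f where "f A = (LEAST i. i = N \<or> \<not> good (Min A) (Max A) (g i))" for A
  have f: "f A \<le> N" "f A = N \<or> \<not> good (Min A) (Max A) (g (f A))" for A
    unfolding f_def using LeastI[of "\<lambda>i. i = N \<or> \<not> good (Min A) (Max A) (g i)" N]
    by (auto intro: Least_le)
  have "\<exists>Y c. Y \<subseteq> UNIV \<and> infinite Y \<and> c < Suc N \<and> (\<forall>m\<in>Y. \<forall>n\<in>Y. m \<noteq> n \<longrightarrow> f {m, n} = c)"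
    using f(1) by (intro Ramsey2) (auto simp: less_Suc_eq_le)
  then obtain Y c where Y: "infinite Y"
    and c: "\<forall>m\<in>Y. \<forall>n\<in>Y. m \<noteq> n \<longrightarrow> f {m, n} = c"
    by (elim exE conjE)
  define u where "u = enumerate Y"
  have u: "u k \<in> Y" "u k < u (Suc k)" for k
    using enumerate_in_set[OF Y] enumerate_step[OF Y] by (auto simp: u_def)
  have fu: "f {u k, u (Suc k)} = c" "Min {u k, u (Suc k)} = u k" "Max {u k, u (Suc k)} = u (Suc k)"
    for k
    using u(2)[of k] c u(1) by auto
  \<comment> \<open>No case distinction on \<open>c\<close>: the average argument holds for every
    vector and scalar, so it also applies to \<open>g c\<close> when \<open>c = N\<close> is past
    the enumeration of \<open>T\<close>.\<close>
  obtain k where "good (u k) (u (Suc k)) (g c)"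
    unfolding good_def using telescoping_average[of "\<lambda>k. z (u k)", OF z e] by blast
  then have "c = N"
    using f(2)[of "{u k, u (Suc k)}"] unfolding fu by blast
  have "good (u 0) (u (Suc 0)) (g i)" if "i < N" for i
  proof -
    have "i < f {u 0, u (Suc 0)}"
      using that \<open>c = N\<close> fu(1)[of 0] by simp
    then show ?thesis
      using not_less_Least[of i "\<lambda>i. i = N \<or> \<not> good (u 0) (u (Suc 0)) (g i)"]
      unfolding f_def fu by blast
  qed
  then have "\<forall>p\<in>T. good (u 0) (u (Suc 0)) p"
    using g by auto
  then show ?thesis
    using u(2)[of 0] by (intro exI[of _ "u 0"] exI[of _ "u (Suc 0)"]) (auto simp: good_def)
qed

text \<open>By homogeneity, unit vectors \<open>y\<close> suffice. They are replaced by a finite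
  net, and so are the scalars \<open>t\<close> of norm at most 4; a single difference
  \<open>w\<close> of the separated sequence is then good for all pairs of net points.\<close>

lemma mazur:
  assumes S: "finite S" and \<eta>: "0 < \<eta>" "\<eta> < 1"
  shows "\<exists>x. nrm x = 1 \<and> (\<forall>y\<in>span S. \<forall>t. (1 - \<eta>) * nrm y \<le> nrm (y + sc t x))"
proof -
  obtain z :: "nat \<Rightarrow> 'a" where z: "\<And>n. nrm (z n) = 1"
    and sep: "\<And>m n. m \<noteq> n \<Longrightarrow> 1 / 2 \<le> nrm (z m - z n)"
    using separated_unit_sequence by blast
  \<comment> \<open>The approximations below lose \<open>5 * e\<close> altogether:
    \<open>3 * e\<close> from moving \<open>y\<close> and \<open>t\<close> to the nets,
    \<open>e\<close> from the choice of \<open>w\<close>, and \<open>e\<close> from comparing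
    \<open>nrm y'\<close> with \<open>nrm y\<close>.\<close>
  define e where "e = \<eta> / 8"
  have e: "e > 0"
    using \<eta> by (simp add: e_def)
  obtain T where T: "finite T" "\<And>y. y \<in> span S \<Longrightarrow> nrm y \<le> 1 \<Longrightarrow> \<exists>y'\<in>T. nrm (y - y') \<le> e"
    using finite_span_totally_bounded[OF S e, of 1] by blast
  \<comment> \<open>Radius 4 is enough: as \<open>nrm w\<close> is at least 1/2, a larger
    \<open>t\<close> gives \<open>sc t w\<close> norm at least 2, and adding a unit vector leaves at
    least 1.\<close>
  obtain K where K: "finite K" "cball (0::'k) 4 \<subseteq> (\<Union>x\<in>K. ball x e)"
    using compact_cball[of "0::'k" 4] e unfolding compact_eq_totally_bounded by metis
  obtain m n where mn: "m < n"
    "\<And>y t. y \<in> T \<Longrightarrow> t \<in> K \<Longrightarrow> nrm y - e \<le> nrm (y + sc t (z m - z n))"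
    using simultaneous_long_differences[of z e "T \<times> K", OF z e] T(1) K(1) by auto
  define w where "w = z m - z n"
  have w: "1 / 2 \<le> nrm w" "nrm w \<le> 2"
    using sep[of m n] mn(1) nrm_triangle_diff[of "z m" "z n"] z by (auto simp: w_def)
  have unit: "1 - \<eta> \<le> nrm (y + sc t w)" if y: "y \<in> span S" "nrm y = 1" for y t
  proof (cases "norm t \<le> 4")
    case True
    obtain t' where t': "t' \<in> K" "norm (t - t') < e"
      using True K(2) by (auto simp: subset_iff dist_norm norm_minus_commute)
    obtain y' where y': "y' \<in> T" "nrm (y - y') \<le> e"
      using T(2) y by force
    have "nrm (y' - y) + norm (t' - t) * nrm w \<le> e + e * 2"
      using y'(2) t'(2) w e
      by (intro add_mono mult_mono) (auto simp: nrm_minus_commute norm_minus_commute)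
    moreover have "nrm (y' + sc t' w) \<le> nrm (y + sc t w) + (nrm (y' - y) + norm (t' - t) * nrm w)"
    proof -
      have eq: "y' + sc t' w = (y + sc t w) + ((y' - y) + sc (t' - t) w)"
        by (simp add: scale_left_diff_distrib)
      show ?thesis
        using nrm_triangle[of "y + sc t w" "(y' - y) + sc (t' - t) w"]
          nrm_triangle[of "y' - y" "sc (t' - t) w"] unfolding eq nrm_scale by linarith
    qed
    moreover have "nrm y' - e \<le> nrm (y' + sc t' w)"
      unfolding w_def using mn(2) y'(1) t'(1) by blast
    moreover have "nrm y - e \<le> nrm y'"
      using nrm_triangle[of "y - y'" y'] y'(2) by simp
    ultimately show ?thesis
      using y(2) e_def e by simp
  next
    case False
    have "4 * (1 / 2) \<le> norm t * nrm w"
      using False w by (intro mult_mono) auto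
    then show ?thesis
      using nrm_add_ge[of "sc t w" y] y(2) \<eta>(1) by (simp add: nrm_scale add.commute)
  qed
  have all: "(1 - \<eta>) * nrm y \<le> nrm (y + sc t w)" if y: "y \<in> span S" for y t
  proof (cases "y = 0")
    case False
    then have pos: "nrm y > 0"
      by (simp add: nrm_pos_iff)
    define c :: 'k where "c = of_real (1 / nrm y)"
    have c: "norm c = 1 / nrm y"
      using pos by (simp add: c_def norm_divide)
    have "1 - \<eta> \<le> nrm (sc c y + sc (c * t) w)"
      using y pos by (intro unit span_scale) (simp_all add: nrm_scale c)
    also have "sc c y + sc (c * t) w = sc c (y + sc t w)"
      by (simp add: scale_right_distrib)
    finally have "1 - \<eta> \<le> norm c * nrm (y + sc t w)"
      unfolding nrm_scale .
    then show ?thesis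
      using pos by (simp add: c field_simps)
  qed simp
  define x where "x = sc (of_real (1 / nrm w)) w"
  have "nrm x = 1"
    using w by (simp add: x_def nrm_scale norm_divide)
  moreover have "(1 - \<eta>) * nrm y \<le> nrm (y + sc t x)" if "y \<in> span S" for y t
    using all[OF that, of "t * of_real (1 / nrm w)"] by (simp add: x_def)
  ultimately show ?thesis
    by blast
qed

section \<open>A basic sequence with almost monotone partial sums, and its uniform
  minimality\<close>

text \<open>Mazur's lemma adds one vector at a time at the cost of a factor close to 1. These
  factors multiply to more than \<open>1 - \<eta>\<close>, so the partial sum projections have norm
  at most \<open>1 / (1 - \<eta>)\<close>.\<close>

lemma basic_sequence:
  assumes \<eta>: "0 < \<eta>" "\<eta> < 1"
  shows "\<exists>x :: nat \<Rightarrow> 'a. (\<forall>n. nrm (x n) = 1) \<and>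
    (\<forall>n. \<forall>y\<in>span (x ` {..<n}). \<forall>w\<in>span (x ` {n..}). (1 - \<eta>) * nrm y \<le> nrm (y + w))"
proof -
  \<comment> \<open>\<open>r\<close> decreases strictly from 1 towards \<open>1 - \<eta>\<close>.
    The factor lost at stage \<open>n\<close> is \<open>r (Suc n) / r n\<close>, so that the product
    telescopes.\<close>
  define r where "r n = 1 - \<eta> + \<eta> * (1 / 2) ^ n" for n :: nat
  have r: "1 - \<eta> < r n" "r n \<le> 1" "r (Suc n) < r n" for n
    using \<eta> power_le_one[of "1 / 2 :: real" n] by (auto simp: r_def algebra_simps)
  have rpos: "0 < r n" for n
    using r(1)[of n] \<eta> by simp
  define P where "P f n v \<longleftrightarrow> nrm v = 1 \<and>
      (\<forall>y\<in>span (f ` {..<n}). \<forall>t. r (Suc n) * nrm y \<le> r n * nrm (y + sc t v))"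
    for f :: "nat \<Rightarrow> 'a" and n v
  have "\<exists>f. \<forall>n. P f n (f n)"
  proof (rule dependent_wellorder_choice)
    show "P f n v = P g n v" if "\<And>y. y < n \<Longrightarrow> f y = g y" for v f g n
    proof -
      have "f ` {..<n} = g ` {..<n}"
        using that by (intro image_cong) auto
      then show ?thesis
        unfolding P_def by simp
    qed
    show "\<exists>v. P f n v" for n f
    proof -
      have "0 < 1 - r (Suc n) / r n" "1 - r (Suc n) / r n < 1"
        using r rpos by auto
      then obtain v where "nrm v = 1"
        "\<And>y t. y \<in> span (f ` {..<n}) \<Longrightarrow> r (Suc n) / r n * nrm y \<le> nrm (y + sc t v)"
        using mazur[of "f ` {..<n}" "1 - r (Suc n) / r n"] by auto
      then show ?thesis
        unfolding P_def using rpos[of n] by (auto simp: field_simps)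
    qed
  qed
  then obtain x where x: "\<And>n. P x n (x n)"
    by blast
  \<comment> \<open>Remove the last vector \<open>x m\<close> from the tail, use its defining
    inequality, and let the ratios telescope.\<close>
  have step: "r m * nrm y \<le> r n * nrm (y + w)"
    if "n \<le> m" "y \<in> span (x ` {..<n})" "w \<in> span (x ` {n..<m})" for n m y w
    using that
  proof (induction m arbitrary: w rule: dec_induct)
    case base
    then show ?case
      by simp
  next
    case (step m)
    have "x ` {n..<Suc m} = insert (x m) (x ` {n..<m})"
      using step.hyps by (simp add: atLeastLessThanSuc)
    then obtain t where t: "w - sc t (x m) \<in> span (x ` {n..<m})"
      using step.prems(2) span_breakdown_eq by metis
    define w' where "w' = w - sc t (x m)"
    have "y + w' \<in> span (x ` {..<m})"
    proof (rule span_add)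
      show "y \<in> span (x ` {..<m})"
        using step.prems(1) step.hyps(1) span_mono[of "x ` {..<n}" "x ` {..<m}"] by fastforce
      show "w' \<in> span (x ` {..<m})"
        using t span_mono[of "x ` {n..<m}" "x ` {..<m}"] by (fastforce simp: w'_def)
    qed
    then have "r (Suc m) * nrm (y + w') \<le> r m * nrm (y + w' + sc t (x m))"
      using x[of m] unfolding P_def by blast
    also have "y + w' + sc t (x m) = y + w"
      by (simp add: w'_def)
    finally have last: "r (Suc m) * nrm (y + w') \<le> r m * nrm (y + w)" .
    have "r m * nrm y \<le> r n * nrm (y + w')"
      using step.IH step.prems(1) t by (simp add: w'_def)
    then have "r (Suc m) * (r m * nrm y) \<le> r (Suc m) * (r n * nrm (y + w'))"
      using rpos[of "Suc m"] by (intro mult_left_mono) auto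
    also have "\<dots> = r n * (r (Suc m) * nrm (y + w'))"
      by simp
    also have "\<dots> \<le> r n * (r m * nrm (y + w))"
      using last rpos[of n] by (intro mult_left_mono) auto
    finally have "r m * (r (Suc m) * nrm y) \<le> r m * (r n * nrm (y + w))"
      by (simp add: mult.left_commute)
    then show ?case
      using rpos[of m] by simp
  qed
  have "(1 - \<eta>) * nrm y \<le> nrm (y + w)"
    if y: "y \<in> span (x ` {..<n})" and w: "w \<in> span (x ` {n..})" for n y w
  proof -
    \<comment> \<open>The span of the infinite tail is the union of the spans of its finite
      segments, which form an increasing chain; this reduces the claim to
      \<open>step\<close>.\<close>
    have "subspace {w. \<exists>m\<ge>n. w \<in> span (x ` {n..<m})}"
    proof (rule subspaceI)
      show "0 \<in> {w. \<exists>m\<ge>n. w \<in> span (x ` {n..<m})}"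
        by (auto intro: span_zero)
      show "sc c w \<in> {w. \<exists>m\<ge>n. w \<in> span (x ` {n..<m})}"
        if "w \<in> {w. \<exists>m\<ge>n. w \<in> span (x ` {n..<m})}" for c w
        using that by (auto intro: span_scale)
      fix a b assume "a \<in> {w. \<exists>m\<ge>n. w \<in> span (x ` {n..<m})}"
        "b \<in> {w. \<exists>m\<ge>n. w \<in> span (x ` {n..<m})}"
      then obtain k l where kl: "n \<le> k" "a \<in> span (x ` {n..<k})" "b \<in> span (x ` {n..<l})"
        by blast
      have "span (x ` {n..<k}) \<subseteq> span (x ` {n..<max k l})"
        "span (x ` {n..<l}) \<subseteq> span (x ` {n..<max k l})"
        by (intro span_mono image_mono; auto)+
      then have "a + b \<in> span (x ` {n..<max k l})"
        using kl(2,3) by (intro span_add) auto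
      then show "a + b \<in> {w. \<exists>m\<ge>n. w \<in> span (x ` {n..<m})}"
        using kl(1) by (auto intro!: exI[of _ "max k l"])
    qed
    moreover have "x ` {n..} \<subseteq> {w. \<exists>m\<ge>n. w \<in> span (x ` {n..<m})}"
    proof (rule image_subsetI, rule CollectI)
      fix k assume "k \<in> {n..}"
      then show "\<exists>m\<ge>n. x k \<in> span (x ` {n..<m})"
        by (intro exI[of _ "Suc k"] conjI span_base) auto
    qed
    ultimately have "span (x ` {n..}) \<subseteq> {w. \<exists>m\<ge>n. w \<in> span (x ` {n..<m})}"
      by (rule span_minimal[rotated])
    then obtain m where m: "m \<ge> n" "w \<in> span (x ` {n..<m})"
      using w by blast
    have "(1 - \<eta>) * nrm y \<le> r m * nrm y"
      using r(1)[of m] by (intro mult_right_mono) auto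
    also have "\<dots> \<le> r n * nrm (y + w)"
      using step[OF m(1) y m(2)] .
    also have "\<dots> \<le> 1 * nrm (y + w)"
      using r(2)[of n] by (intro mult_right_mono) auto
    finally show ?thesis
      by simp
  qed
  then show ?thesis
    using x unfolding P_def by blast
qed

text \<open>
  Every vector of \<open>span (x ` (- {i}))\<close> splits at the index \<open>i\<close> into \<open>a + w\<close>; then \<open>x i - a\<close> and
  \<open>a\<close> are both controlled by \<open>x i - (a + w)\<close>, and one of them has norm at least \<open>1 / 2\<close>.
\<close>

lemma basic_sequence_uniformly_minimal:
  assumes x: "\<And>n::nat. nrm (x n) = 1"
    and basic: "\<And>n y w. y \<in> span (x ` {..<n}) \<Longrightarrow> w \<in> span (x ` {n..}) \<Longrightarrow>
      (1 - \<eta>) * nrm y \<le> nrm (y + w)"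
    and \<eta>: "0 < \<eta>" "\<eta> < 1"
  shows "(1 - \<eta>) / 2 \<le> quotient_nrm (span (x ` (- {i}))) (x i)"
proof (rule quotient_nrm_greatest[OF subspace_span])
  fix z assume "z \<in> span (x ` (- {i}))"
  moreover have "- {i} = {..<i} \<union> {Suc i..}"
    by auto
  ultimately have "z \<in> span (x ` {..<i} \<union> x ` {Suc i..})"
    by (simp add: image_Un)
  then obtain a w where z: "z = a + w" and a: "a \<in> span (x ` {..<i})"
    and w: "w \<in> span (x ` {Suc i..})"
    unfolding span_Un by blast
  \<comment> \<open>Cut at \<open>i\<close>: here \<open>x i\<close> counts as part of the
    tail.\<close>
  have "(1 - \<eta>) * nrm (- a) \<le> nrm (- a + (x i - w))"
  proof (rule basic[OF span_neg[OF a] span_diff])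
    show "x i \<in> span (x ` {i..})"
      by (intro span_base) auto
    show "w \<in> span (x ` {i..})"
      using w span_mono[of "x ` {Suc i..}" "x ` {i..}"] by fastforce
  qed
  \<comment> \<open>Cut at \<open>Suc i\<close>: now \<open>x i\<close> counts as part of the
    head.\<close>
  moreover have "(1 - \<eta>) * nrm (x i - a) \<le> nrm ((x i - a) + - w)"
  proof (rule basic[OF span_diff span_neg[OF w]])
    show "x i \<in> span (x ` {..<Suc i})"
      by (intro span_base) auto
    show "a \<in> span (x ` {..<Suc i})"
      using a span_mono[of "x ` {..<i}" "x ` {..<Suc i}"] by fastforce
  qed
  moreover have "- a + (x i - w) = x i - z" "(x i - a) + - w = x i - z"
    by (simp_all add: z)
  ultimately have "(1 - \<eta>) * nrm a \<le> nrm (x i - z)" "(1 - \<eta>) * nrm (x i - a) \<le> nrm (x i - z)"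
    by (simp_all only: nrm_minus)
  moreover have "1 \<le> nrm (x i - a) + nrm a"
    using nrm_triangle[of "x i - a" a] x by simp
  then have "(1 - \<eta>) * 1 \<le> (1 - \<eta>) * (nrm (x i - a) + nrm a)"
    using \<eta> by (intro mult_left_mono) auto
  ultimately show "(1 - \<eta>) / 2 \<le> nrm (x i - z)"
    by (simp add: distrib_left)
qed

section \<open>The renorming\<close>

theorem symmetrically_separated_renorming:
  assumes \<epsilon>: "\<epsilon> > 0"
  shows "\<exists>N. normed_space_over sc N \<and> (\<forall>x. nrm x \<le> N x \<and> N x \<le> (1 + \<epsilon>) * nrm x) \<and>
    (\<exists>\<delta>>0. \<exists>A\<subseteq>{x. N x = 1}. infinite A \<and> symmetrically_separated N (1 + \<delta>) A)"
proof -
  \<comment> \<open>The seminorm \<open>p\<close> below is at most \<open>8 * nrm\<close>, so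
    \<open>e * p\<close> adds at most \<open>\<epsilon> * nrm\<close>.\<close>
  define e where "e = \<epsilon> / 8"
  have e: "e > 0"
    using \<epsilon> by (simp add: e_def)
  \<comment> \<open>The bound 1/2 keeps the distances of \<open>x i\<close> to \<open>V i\<close>
    above 1/4. The bound \<open>e / 2\<close> lets the gain \<open>2 * e\<close> from
    \<open>p\<close> on a pair outweigh the loss \<open>\<eta>\<close> and the value
    \<open>1 + e\<close> of the new norm at a single \<open>x n\<close>.\<close>
  define \<eta> where "\<eta> = min (1 / 2) (e / 2)"
  have \<eta>: "0 < \<eta>" "\<eta> < 1" "\<eta> \<le> 1 / 2" "\<eta> \<le> e / 2"
    using e by (auto simp: \<eta>_def)
  obtain x :: "nat \<Rightarrow> 'a" where x: "\<And>n. nrm (x n) = 1"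
    and basic: "\<And>n y w. y \<in> span (x ` {..<n}) \<Longrightarrow> w \<in> span (x ` {n..}) \<Longrightarrow>
      (1 - \<eta>) * nrm y \<le> nrm (y + w)"
    using basic_sequence[OF \<eta>(1,2)] by blast
  define V where "V i = span (x ` (- {i}))" for i
  have V: "subspace (V i)" for i
    by (simp add: V_def)
  have xV: "x j \<in> V i" if "j \<noteq> i" for i j
    unfolding V_def using that by (intro span_base) auto
  have low: "1 / 4 \<le> quotient_nrm (V i) (x i)" for i
    proof -
    have "(1 - \<eta>) / 2 \<le> quotient_nrm (V i) (x i)"
      unfolding V_def by (rule basic_sequence_uniformly_minimal[OF x basic \<eta>(1,2)])
    then show ?thesis
      using \<eta>(3) by simp
  qed
  \<comment> \<open>\<open>g i\<close> stands in for the absolute value of the \<open>i\<close>-th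
    biorthogonal functional.\<close>
  define g where "g i v = quotient_nrm (V i) v / quotient_nrm (V i) (x i)" for i v
  have pos: "quotient_nrm (V i) (x i) > 0" for i
    using low[of i] by simp
  have g_add: "g i (a + b) \<le> g i a + g i b" for i a b
    unfolding g_def using quotient_nrm_triangle[OF V] pos
    by (simp add: add_divide_distrib[symmetric] divide_right_mono less_imp_le)
  have g_scale: "g i (sc c a) = norm c * g i a" for i a c
    by (simp add: g_def quotient_nrm_scale[OF V])
  have g_nonneg: "0 \<le> g i a" for i a
    unfolding g_def using quotient_nrm_nonneg[OF V] by simp
  have g_le: "g i a \<le> 4 * nrm a" for i a
  proof -
    have "g i a \<le> nrm a / (1 / 4)"
      unfolding g_def using quotient_nrm_le[OF V] low by (intro frac_le) auto
    then show ?thesis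
      by simp
  qed
  have g_self: "g i (x i) = 1" for i
    using pos[of i] by (simp add: g_def)
  have g_other: "g i (x j) = 0" if "j \<noteq> i" for i j
    using that by (simp add: g_def quotient_nrm_eq_0[OF V xV])
  have g_cancel: "g i (a + b) = g i a" if "b \<in> V i" for i a b
    using that by (simp add: g_def quotient_nrm_add_cancel[OF V])
  \<comment> \<open>Distinct indices are essential: \<open>x n\<close> is seen by one summand only,
    so \<open>p (x n)\<close> is 1, while both summands see a combination of two different
    vectors.\<close>
  define I where "I = {(i, j). i \<noteq> (j::nat)}"
  define h where "h v = (\<lambda>(i, j). g i v + g j v)" for v
  define p where "p v = (SUP ij\<in>I. h v ij)" for v
  have I: "I \<noteq> {}"
    unfolding I_def using n_not_Suc_n by blast
  have h_le: "h v ij \<le> 8 * nrm v" for v ij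
    using g_le[of "fst ij" v] g_le[of "snd ij" v] by (simp add: h_def split_beta)
  then have bdd: "bdd_above (h v ` I)" for v
    by (intro bdd_aboveI[of _ "8 * nrm v"]) auto
  have p_upper: "g i v + g j v \<le> p v" if "i \<noteq> j" for i j v
    using cSUP_upper[OF _ bdd, of "(i, j)" v] that by (simp add: p_def h_def I_def)
  have p_least: "p v \<le> c" if "\<And>i j. i \<noteq> j \<Longrightarrow> g i v + g j v \<le> c" for v c
    unfolding p_def using that by (intro cSUP_least[OF I]) (auto simp: h_def I_def)
  have p_nonneg: "0 \<le> p v" for v
    using p_upper[of 0 1 v] g_nonneg[of 0 v] g_nonneg[of 1 v] by simp
  have p_le: "p v \<le> 8 * nrm v" for v
  proof (rule p_least)
    show "g i v + g j v \<le> 8 * nrm v" for i j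
      using g_le[of i v] g_le[of j v] by simp
  qed
  have p_add: "p (a + b) \<le> p a + p b" for a b
  proof (rule p_least)
    fix i j :: nat assume "i \<noteq> j"
    then show "g i (a + b) + g j (a + b) \<le> p a + p b"
      using g_add[of i a b] g_add[of j a b] p_upper[of i j a] p_upper[of i j b] by simp
  qed
  have p_scale_le: "p (sc c a) \<le> norm c * p a" for c a
    by (rule p_least) (simp add: g_scale distrib_left[symmetric] mult_left_mono p_upper)
  have p_scale: "p (sc c a) = norm c * p a" for c a
  proof (cases "c = 0")
    case True
    then show ?thesis
      using p_scale_le[of c a] p_nonneg[of "sc c a"] by simp
  next
    case False
    then have "p a \<le> norm (inverse c) * p (sc c a)"
      using p_scale_le[of "inverse c" "sc c a"] by simp
    then have "norm c * p a \<le> p (sc c a)"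
      using False by (simp add: norm_divide field_simps)
    then show ?thesis
      using p_scale_le[of c a] by simp
  qed
  have p_x: "p (x n) = 1" for n
  proof (rule antisym)
    show "p (x n) \<le> 1"
    proof (rule p_least)
      fix i j :: nat assume "i \<noteq> j"
      then show "g i (x n) + g j (x n) \<le> 1"
        using g_self g_other by (cases "n = i"; cases "n = j") auto
    qed
    show "1 \<le> p (x n)"
      using p_upper[of n "Suc n" "x n"] g_self[of n] g_nonneg[of "Suc n" "x n"] by simp
  qed
  \<comment> \<open>Modulo \<open>V m\<close> the vector is \<open>x m\<close>, and modulo
    \<open>V n\<close> it is \<open>sc s (x n)\<close>. Taking \<open>s\<close> of norm 1 treats
    both signs together.\<close>
  have p_pair: "2 \<le> p (x m + sc s (x n))" if "m \<noteq> n" "norm s = 1" for m n s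
  proof -
    have "g m (x m + sc s (x n)) = 1"
      using that by (subst g_cancel) (auto intro: subspace_scale[OF V] xV simp: g_self)
    moreover have "g n (x m + sc s (x n)) = 1"
      using that by (subst add.commute, subst g_cancel) (auto intro: xV simp: g_scale g_self)
    ultimately show ?thesis
      using p_upper[of m n "x m + sc s (x n)"] that by simp
  qed
  \<comment> \<open>The basic sequence inequality needs the smaller index in the head. In the other
    order, factor out \<open>s\<close>, which preserves the norm.\<close>
  have nrm_pair: "1 - \<eta> \<le> nrm (x m + sc s (x n))" if "m \<noteq> n" "norm s = 1" for m n s
  proof -
    have less: "1 - \<eta> \<le> nrm (x k + sc c (x l))" if "k < l" for k l c
    proof -
      have "(1 - \<eta>) * nrm (x k) \<le> nrm (x k + sc c (x l))"
        using that by (intro basic[of _ l] span_scale span_base) auto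
      then show ?thesis
        by (simp add: x)
    qed
    show ?thesis
    proof (cases "m < n")
      case True
      then show ?thesis
        by (rule less)
    next
      case False
      have "s \<noteq> 0"
        using that by auto
      then have "x m + sc s (x n) = sc s (x n + sc (inverse s) (x m))"
        by (simp add: scale_right_distrib add.commute)
      then have "nrm (x m + sc s (x n)) = nrm (x n + sc (inverse s) (x m))"
        using that by (simp add: nrm_scale)
      then show ?thesis
        using less[of n m] False that by simp
    qed
  qed
  define N where "N v = nrm v + e * p v" for v
  have N: "normed_space_over sc N"
  proof unfold_locales
    fix a b c
    show "N a = 0 \<longleftrightarrow> a = 0"
      using p_nonneg[of a] e p_scale[of 0 a]
      by (auto simp: N_def add_nonneg_eq_0_iff nrm_eq_0_iff)
    show "N (a + b) \<le> N a + N b"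
      using nrm_triangle[of a b] mult_left_mono[OF p_add[of a b], of e] e
      by (simp add: N_def distrib_left)
    show "N (sc c a) = norm c * N a"
      by (simp add: N_def nrm_scale p_scale distrib_left)
  qed
  have N_bounds: "nrm v \<le> N v \<and> N v \<le> (1 + \<epsilon>) * nrm v" for v
    using mult_left_mono[OF p_le[of v], of e] p_nonneg[of v] e
    by (simp add: N_def e_def distrib_right)
  \<comment> \<open>Since \<open>N (x n) = 1 + e\<close>, scaling by \<open>c\<close> moves the
    sequence to the new unit sphere.\<close>
  define c :: 'k where "c = of_real (1 / (1 + e))"
  have c: "norm c = 1 / (1 + e)"
    using e by (simp add: c_def norm_divide del: of_real_add)
  \<comment> \<open>Before scaling, the separation is at least \<open>1 - \<eta> + 2 * e\<close>,
    hence at least \<open>1 + e + e / 2\<close>; dividing by \<open>1 + e\<close> gives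
    \<open>1 + \<delta>\<close>.\<close>
  define \<delta> where "\<delta> = e / 2 / (1 + e)"
  have \<delta>: "\<delta> > 0"
    using e by (simp add: \<delta>_def)
  have N_unit: "N (sc c (x n)) = 1" for n
    using e by (simp add: N_def nrm_scale p_scale x p_x c divide_simps)
  have N_sep: "1 + \<delta> \<le> N (sc c (x m) + sc s (sc c (x n)))" if "m \<noteq> n" "norm s = 1" for m n s
  proof -
    have "(1 + e + e / 2) / (1 + e) \<le> N (x m + sc s (x n)) / (1 + e)"
      using nrm_pair[OF that] mult_left_mono[OF p_pair[OF that], of e] e \<eta>(4)
      unfolding N_def by (intro divide_right_mono) linarith+
    also have "\<dots> = N (sc c (x m + sc s (x n)))"
      by (simp add: normed_space_over.nrm_scale[OF N] c)
    also have "sc c (x m + sc s (x n)) = sc c (x m) + sc s (sc c (x n))"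
      by (simp add: scale_right_distrib mult.commute)
    also have "(1 + e + e / 2) / (1 + e) = 1 + \<delta>"
      using e unfolding \<delta>_def add_divide_distrib[of "1 + e"] by simp
    finally show ?thesis .
  qed
  define A where "A = range (\<lambda>n. sc c (x n))"
  \<comment> \<open>Separation with \<open>s = - 1\<close> already forces injectivity: a coincidence
    would give \<open>1 + \<delta> \<le> N 0\<close>.\<close>
  have "inj (\<lambda>n. sc c (x n))"
  proof (rule injI, rule ccontr)
    fix m n assume eq: "sc c (x m) = sc c (x n)" and "m \<noteq> n"
    then have "1 + \<delta> \<le> N (sc c (x m) + sc (- 1) (sc c (x n)))"
      by (intro N_sep) auto
    also have "sc c (x m) + sc (- 1) (sc c (x n)) = 0"
      using eq by simp
    also have "N 0 = 0"
      using N normed_space_over.nrm_zero by blast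
    finally show False
      using \<delta> by simp
  qed
  then have "infinite A"
    unfolding A_def by (rule range_inj_infinite)
  moreover have "symmetrically_separated N (1 + \<delta>) A"
    unfolding symmetrically_separated_def
  proof (intro ballI impI)
    fix a b assume "a \<in> A" "b \<in> A" "a \<noteq> b"
    then obtain m n where ab: "a = sc c (x m)" "b = sc c (x n)" "m \<noteq> n"
      by (auto simp: A_def)
    show "1 + \<delta> \<le> N (a + b) \<and> 1 + \<delta> \<le> N (a - b)"
      using N_sep[OF ab(3), of 1] N_sep[OF ab(3), of "- 1"] by (simp add: ab)
  qed
  moreover have "A \<subseteq> {x. N x = 1}"
    by (auto simp: A_def N_unit)
  ultimately show ?thesis
    using N N_bounds \<delta> by blast
qed

end

section \<open>Specialisation to real and to complex scalars\<close>

theorem proposition5p2: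
  fixes scaleC :: "complex \<Rightarrow> 'a::banach \<Rightarrow> 'a" and \<epsilon> :: real
  assumes "\<epsilon> > 0"
  shows
    "(infinite_dimensional (scaleR :: real \<Rightarrow> 'a \<Rightarrow> 'a) \<longrightarrow>
       (\<exists>N :: 'a \<Rightarrow> real.
          normed_space_over (scaleR :: real \<Rightarrow> 'a \<Rightarrow> 'a) N \<and> equivalent_norms norm N \<and>
          (\<forall>x. norm x \<le> N x \<and> N x \<le> (1 + \<epsilon>) * norm x) \<and>
          (\<exists>\<delta>>0. \<exists>A \<subseteq> {x. N x = 1}. infinite A \<and> symmetrically_separated N (1 + \<delta>) A)))
     \<and>
     (complex_banach_structure scaleC \<and> infinite_dimensional scaleC \<longrightarrow>
       (\<exists>N :: 'a \<Rightarrow> real.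
          normed_space_over scaleC N \<and> equivalent_norms norm N \<and>
          (\<forall>x. norm x \<le> N x \<and> N x \<le> (1 + \<epsilon>) * norm x) \<and>
          (\<exists>\<delta>>0. \<exists>A \<subseteq> {x. N x = 1}. infinite A \<and> symmetrically_separated N (1 + \<delta>) A)))"
proof -
  have equiv: "equivalent_norms norm N"
    if "\<forall>x. norm x \<le> N x \<and> N x \<le> (1 + \<epsilon>) * norm x" for N :: "'a \<Rightarrow> real"
    unfolding equivalent_norms_def using that assms
    by (intro exI[of _ 1] conjI exI[of _ "1 + \<epsilon>"]) auto
  have real: "normed_space_over (scaleR :: real \<Rightarrow> 'a \<Rightarrow> 'a) norm"
    by unfold_locales (auto simp: algebra_simps norm_triangle_ineq)
  show ?thesis
  proof (intro conjI impI)
    assume "infinite_dimensional (scaleR :: real \<Rightarrow> 'a \<Rightarrow> 'a)"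
    with real have "infinite_dimensional_normed_space (scaleR :: real \<Rightarrow> 'a \<Rightarrow> 'a) norm"
      by (simp add: infinite_dimensional_normed_space_def
          infinite_dimensional_normed_space_axioms_def)
    from infinite_dimensional_normed_space.symmetrically_separated_renorming[OF this assms] equiv
    show "\<exists>N :: 'a \<Rightarrow> real.
          normed_space_over (scaleR :: real \<Rightarrow> 'a \<Rightarrow> 'a) N \<and> equivalent_norms norm N \<and>
          (\<forall>x. norm x \<le> N x \<and> N x \<le> (1 + \<epsilon>) * norm x) \<and>
          (\<exists>\<delta>>0. \<exists>A \<subseteq> {x. N x = 1}. infinite A \<and> symmetrically_separated N (1 + \<delta>) A)"
      by blast
  next
    assume "complex_banach_structure scaleC \<and> infinite_dimensional scaleC"
    then have "infinite_dimensional_normed_space scaleC norm"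
      by (simp add: complex_banach_structure_def infinite_dimensional_normed_space_def
          infinite_dimensional_normed_space_axioms_def)
    from infinite_dimensional_normed_space.symmetrically_separated_renorming[OF this assms] equiv
    show "\<exists>N :: 'a \<Rightarrow> real.
          normed_space_over scaleC N \<and> equivalent_norms norm N \<and>
          (\<forall>x. norm x \<le> N x \<and> N x \<le> (1 + \<epsilon>) * norm x) \<and>
          (\<exists>\<delta>>0. \<exists>A \<subseteq> {x. N x = 1}. infinite A \<and> symmetrically_separated N (1 + \<delta>) A)"
      by blast
  qed
qed

end
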